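(* Let $X$ be a Hausdorff topological space. Then $X$ has an open uniform (G) at non-isolated points if and only if $X$ has a uniform base at non-isolated points.
   Context: For a topological space $X$, $\tau(X)$ denotes its topology, $I(X)$ the set of isolated points of $X$, and $X^{d}=X\setminus I(X)$ the set of non-isolated points. $\mathbb{N}$ is the set of positive integers. Uniform base at non-isolated points: a base $\mathcal{P}$ of $X$ such that for each non-isolated point $x\in X$ and any countably infinite subset $\mathcal{P}'$ of $\{P\in\mathcal{P}: x\in P\}$, $\mathcal{P}'$ is a neighborhood base at $x$ in $X$. Open uniform (G) at non-isolated points: $X$ has one if there exists an assignment $\mathcal{W}=\{\mathcal{W}_{x}: x\in X\}$, where each $\mathcal{W}_x$ is a family of open subsets of $X$, such that: (1) for each $x\in X$, $x\in\bigcap\mathcal{W}_{x}$ and $|\mathcal{W}_{x}|\le\aleph_{0}$; (2) for each $x\in U\in\tau(X)$ there exists an open neighborhood $V(x,U)$ of $x$ such that for each $y\in V(x,U)\cap X^{d}$ there is a $W\in\mathcal{W}_{y}$ with $x\in W\subset U$; (3) for each $x\in X$, every infinite subfamily $\mathcal{W}_{x}'\subset\mathcal{W}_{x}$ is a network at $x$ (i.e. for every open $U\ni x$ there is $W\in\mathcal{W}_x'$ with $x\in W\subset U$). *)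

theory Defs
  imports "HOL-Analysis.Analysis"
begin

definition isolated_points :: "'a topology \<Rightarrow> 'a set" where
  "isolated_points X = {x \<in> topspace X. openin X {x}}"

definition nonisolated_points :: "'a topology \<Rightarrow> 'a set" where
  "nonisolated_points X = topspace X - isolated_points X"

definition is_base_of :: "'a set set \<Rightarrow> 'a topology \<Rightarrow> bool" where
  "is_base_of \<P> X \<longleftrightarrow>
     (\<forall>P\<in>\<P>. openin X P) \<and>
     (\<forall>U x. openin X U \<and> x \<in> U \<longrightarrow> (\<exists>P\<in>\<P>. x \<in> P \<and> P \<subseteq> U))"

(* neighbourhood_base_at does not itself demand that the members of \<Q> be
   neighbourhoods of x; here they are, being open sets containing x. *)
definition uniform_base_at_nonisolated :: "'a topology \<Rightarrow> 'a set set \<Rightarrow> bool" where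
  "uniform_base_at_nonisolated X \<P> \<longleftrightarrow>
     is_base_of \<P> X \<and>
     (\<forall>x \<in> nonisolated_points X. \<forall>\<Q>.
        \<Q> \<subseteq> {P \<in> \<P>. x \<in> P} \<and> countable \<Q> \<and> infinite \<Q>
        \<longrightarrow> neighbourhood_base_at x (\<lambda>P. P \<in> \<Q>) X)"

definition has_uniform_base_at_nonisolated :: "'a topology \<Rightarrow> bool" where
  "has_uniform_base_at_nonisolated X \<longleftrightarrow> (\<exists>\<P>. uniform_base_at_nonisolated X \<P>)"

definition network_at :: "'a topology \<Rightarrow> 'a \<Rightarrow> 'a set set \<Rightarrow> bool" where
  "network_at X x \<N> \<longleftrightarrow>
     (\<forall>U. openin X U \<and> x \<in> U \<longrightarrow> (\<exists>W\<in>\<N>. x \<in> W \<and> W \<subseteq> U))"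

definition open_uniform_G_at_nonisolated ::
  "'a topology \<Rightarrow> ('a \<Rightarrow> 'a set set) \<Rightarrow> bool" where
  "open_uniform_G_at_nonisolated X \<W> \<longleftrightarrow>
     (\<forall>x \<in> topspace X. \<forall>W \<in> \<W> x. openin X W) \<and>
     (\<forall>x \<in> topspace X. x \<in> \<Inter>(\<W> x) \<and> countable (\<W> x)) \<and>
     (\<forall>x U. openin X U \<and> x \<in> U \<longrightarrow>
        (\<exists>V. openin X V \<and> x \<in> V \<and>
           (\<forall>y \<in> V \<inter> nonisolated_points X. \<exists>W \<in> \<W> y. x \<in> W \<and> W \<subseteq> U))) \<and>
     (\<forall>x \<in> topspace X. \<forall>\<W>'. \<W>' \<subseteq> \<W> x \<and> infinite \<W>' \<longrightarrow> network_at X x \<W>')"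

definition has_open_uniform_G_at_nonisolated :: "'a topology \<Rightarrow> bool" where
  "has_open_uniform_G_at_nonisolated X \<longleftrightarrow> (\<exists>\<W>. open_uniform_G_at_nonisolated X \<W>)"

end

theory Submission
  imports Defs
begin

text \<open>
  Suppose \<open>\<W>\<close> is an open uniform (G) and well-order the index set of an open cover \<open>U\<close>. Shrinking
  \<open>U i\<close> to the union of the neighbourhoods \<open>V(z, U i)\<close> over those \<open>z\<close> whose first index is \<open>i\<close> gives
  a cover that is point-finite at non-isolated points: different indices \<open>i\<close> at \<open>y\<close> yield different
  members of \<open>\<W> y\<close>, and almost all of these would lie in the first \<open>U i\<close> that contains \<open>y\<close>.

  Iterating, one builds point-finite covers \<open>(V n p)\<close> indexed by centres \<open>p\<close>, where \<open>V (Suc n) p\<close> lies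
  in a neighbourhood \<open>B p\<close> of \<open>p\<close> that omits every earlier centre \<open>x \<noteq> p\<close> above \<open>p\<close> and is contained in
  every \<open>W \<in> \<W> x\<close> with \<open>p \<in> W\<close>. If infinitely many \<open>V n p\<close> contained a non-isolated \<open>y\<close> without being
  inside a given neighbourhood \<open>U\<close> of \<open>y\<close>, then Koenig's lemma would give a decreasing chain of
  such sets. If its centres are eventually constant the chain shrinks to \<open>y\<close>. Otherwise
  omitting old centres produces infinitely many members of \<open>\<W> y\<close> meeting the centres, so the centres
  accumulate at \<open>y\<close>; an early centre \<open>x\<close> has \<open>W \<in> \<W> x\<close> with \<open>y \<in> W \<subseteq> U\<close>, and any later
  centre in \<open>W\<close> forces its set into \<open>W\<close>. So the sets \<open>V n p\<close> together with the isolated singletons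
  form the required base.
\<close>

section \<open>Koenig's lemma and preliminaries on T1 spaces\<close>

text \<open>By finite branching, a vertex with infinitely many descendants has a successor with
  infinitely many; dependent choice follows such successors forever.\<close>

lemma koenig:
  assumes fin: "\<And>v. finite {w. R v w}" and inf: "infinite {w. R\<^sup>*\<^sup>* v w}"
  obtains f :: "nat \<Rightarrow> 'v" where "f 0 = v" "\<And>n. R (f n) (f (Suc n))"
proof -
  have step: "\<exists>w. infinite {u. R\<^sup>*\<^sup>* w u} \<and> R v w" if "infinite {u. R\<^sup>*\<^sup>* v u}" for v
  proof (rule ccontr)
    assume "\<not> ?thesis"
    then have "finite (insert v (\<Union>w\<in>{w. R v w}. {u. R\<^sup>*\<^sup>* w u}))"
      using fin by auto
    moreover have "{u. R\<^sup>*\<^sup>* v u} \<subseteq> insert v (\<Union>w\<in>{w. R v w}. {u. R\<^sup>*\<^sup>* w u})"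
      by (auto elim: converse_rtranclpE)
    ultimately show False
      using that finite_subset by blast
  qed
  have "\<exists>f. \<forall>n. (infinite {u. R\<^sup>*\<^sup>* (f n) u} \<and> (n = 0 \<longrightarrow> f n = v)) \<and> R (f n) (f (Suc n))"
    by (rule dependent_nat_choice) (use inf step in auto)
  then show thesis
    using that by blast
qed

lemma nonisolated_points_iff:
  "x \<in> nonisolated_points X \<longleftrightarrow> x \<in> topspace X \<and> \<not> openin X {x}"
  by (auto simp: nonisolated_points_def isolated_points_def)

lemma openin_nonisolated_obtain:
  assumes "x \<in> nonisolated_points X" "openin X U" "x \<in> U"
  obtains y where "y \<in> U" "y \<noteq> x"
proof -
  have "U \<noteq> {x}"
    using assms by (auto simp: nonisolated_points_iff)
  with assms that show thesis
    by auto
qed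

lemma openin_delete:
  assumes "t1_space X" "openin X U"
  shows "openin X (U - {x})"
proof (cases "x \<in> topspace X")
  case True
  then show ?thesis
    using assms by (simp add: closedin_t1_singleton openin_diff)
next
  case False
  then show ?thesis
    using assms openin_subset by (metis Diff_empty Diff_insert0 subsetD)
qed

section \<open>From a uniform base to an open uniform (G)\<close>

text \<open>The definition speaks of countable subfamilies, but every infinite \<open>\<Q>\<close>
  contains a countably infinite one, and being a network passes to larger families.\<close>

lemma uniform_base_network:
  assumes "uniform_base_at_nonisolated X \<P>" "x \<in> nonisolated_points X"
    "\<Q> \<subseteq> {P \<in> \<P>. x \<in> P}" "infinite \<Q>"
  shows "network_at X x \<Q>"
proof -
  obtain \<Q>' where "\<Q>' \<subseteq> \<Q>" "countable \<Q>'" "infinite \<Q>'"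
    using infinite_countable_subset'[OF assms(4)] by blast
  then have base: "neighbourhood_base_at x (\<lambda>P. P \<in> \<Q>') X"
    using assms unfolding uniform_base_at_nonisolated_def by (meson order_trans)
  show ?thesis
    unfolding network_at_def
  proof (intro allI impI)
    fix U assume "openin X U \<and> x \<in> U"
    then obtain T Q where "Q \<in> \<Q>'" "x \<in> T" "T \<subseteq> Q" "Q \<subseteq> U"
      using base unfolding neighbourhood_base_at_def by meson
    then show "\<exists>W\<in>\<Q>. x \<in> W \<and> W \<subseteq> U"
      using \<open>\<Q>' \<subseteq> \<Q>\<close> by blast
  qed
qed

text \<open>If infinitely many \<open>P\<close> contain \<open>x\<close>, fix a countably infinite
  \<open>\<Q>\<close> among them and a point \<open>f Q \<noteq> x\<close> in each \<open>Q\<close>.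
  Every \<open>P\<close> around \<open>x\<close> includes some \<open>Q\<close>, hence contains
  \<open>f Q\<close>, and T1 separation allows only finitely many \<open>P\<close> for each
  \<open>f Q\<close>.\<close>

lemma uniform_base_point_countable:
  assumes "t1_space X" and base: "uniform_base_at_nonisolated X \<P>" and x: "x \<in> nonisolated_points X"
  shows "countable {P \<in> \<P>. x \<in> P}"
proof (cases "finite {P \<in> \<P>. x \<in> P}")
  case True
  then show ?thesis by (rule countable_finite)
next
  case False
  then obtain \<Q> where \<Q>: "\<Q> \<subseteq> {P \<in> \<P>. x \<in> P}" "countable \<Q>" "infinite \<Q>"
    using infinite_countable_subset' by blast
  have opn: "openin X P" if "P \<in> \<P>" for P
    using base that by (auto simp: uniform_base_at_nonisolated_def is_base_of_def)
  have "\<exists>y. y \<in> Q \<and> y \<noteq> x" if "Q \<in> \<Q>" for Q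
    using openin_nonisolated_obtain[OF x opn] \<Q>(1) that by blast
  then obtain f where f: "\<And>Q. Q \<in> \<Q> \<Longrightarrow> f Q \<in> Q \<and> f Q \<noteq> x"
    by metis
  have fin: "finite {P \<in> \<P>. x \<in> P \<and> f Q \<in> P}" if "Q \<in> \<Q>" for Q
  proof (rule ccontr)
    assume inf: "infinite {P \<in> \<P>. x \<in> P \<and> f Q \<in> P}"
    have "network_at X x {P \<in> \<P>. x \<in> P \<and> f Q \<in> P}"
      using inf by (intro uniform_base_network[OF base x]) auto
    moreover have "openin X (topspace X - {f Q})" "x \<in> topspace X - {f Q}"
      using openin_delete[OF assms(1) openin_topspace] f[OF that] x
      by (auto simp: nonisolated_points_iff)
    ultimately show False
      unfolding network_at_def by blast
  qed
  have "{P \<in> \<P>. x \<in> P} \<subseteq> (\<Union>Q\<in>\<Q>. {P \<in> \<P>. x \<in> P \<and> f Q \<in> P})"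
  proof
    fix P assume P: "P \<in> {P \<in> \<P>. x \<in> P}"
    then obtain Q where "Q \<in> \<Q>" "Q \<subseteq> P"
      using uniform_base_network[OF base x \<Q>(1,3)] opn unfolding network_at_def by blast
    then show "P \<in> (\<Union>Q\<in>\<Q>. {P \<in> \<P>. x \<in> P \<and> f Q \<in> P})"
      using P f by blast
  qed
  then show ?thesis
    using \<Q>(2) fin by (meson countable_UN countable_finite countable_subset)
qed

text \<open>A base member \<open>P\<close> with \<open>x \<in> P\<close> and
  \<open>P \<subseteq> U\<close> serves both as \<open>V\<close> and as the \<open>W\<close> for
  every \<open>y\<close> in it. The value \<open>{{x}}\<close> at isolated points is finite, so the
  network clause is vacuous there.\<close>

lemma uniform_base_imp_open_uniform_G:
  assumes t1: "t1_space X" and base: "uniform_base_at_nonisolated X \<P>"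
  shows "open_uniform_G_at_nonisolated X
    (\<lambda>x. if x \<in> nonisolated_points X then {P \<in> \<P>. x \<in> P} else {{x}})"
    (is "open_uniform_G_at_nonisolated X ?W")
  unfolding open_uniform_G_at_nonisolated_def
proof (intro conjI ballI allI impI)
  have opn: "openin X P" if "P \<in> \<P>" for P
    using base that by (auto simp: uniform_base_at_nonisolated_def is_base_of_def)
  show "openin X W" if "x \<in> topspace X" "W \<in> ?W x" for x W
    using that opn by (auto simp: nonisolated_points_iff split: if_splits)
  show "x \<in> \<Inter> (?W x)" "countable (?W x)" for x
    using uniform_base_point_countable[OF t1 base] by auto
  show "\<exists>V. openin X V \<and> x \<in> V \<and>
      (\<forall>y\<in>V \<inter> nonisolated_points X. \<exists>W\<in>?W y. x \<in> W \<and> W \<subseteq> U)"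
    if "openin X U \<and> x \<in> U" for x U
  proof -
    have "\<exists>P\<in>\<P>. x \<in> P \<and> P \<subseteq> U"
      using base that by (simp add: uniform_base_at_nonisolated_def is_base_of_def)
    then obtain P where P: "P \<in> \<P>" "x \<in> P" "P \<subseteq> U"
      by blast
    show ?thesis
      using P opn by (intro exI[of _ P]) auto
  qed
  show "network_at X x \<W>'" if "\<W>' \<subseteq> ?W x \<and> infinite \<W>'" for x \<W>'
  proof -
    have "x \<in> nonisolated_points X"
      using that finite_subset[of \<W>' "{{x}}"] by (auto split: if_splits)
    then show ?thesis
      using that by (intro uniform_base_network[OF base]) (auto split: if_splits)
  qed
qed

section \<open>From an open uniform (G) to a uniform base\<close>

context
  fixes X :: "'a topology" and \<W> :: "'a \<Rightarrow> 'a set set"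
  assumes G: "open_uniform_G_at_nonisolated X \<W>"
begin

lemma G_open: "x \<in> topspace X \<Longrightarrow> W \<in> \<W> x \<Longrightarrow> openin X W"
  and G_mem: "x \<in> topspace X \<Longrightarrow> W \<in> \<W> x \<Longrightarrow> x \<in> W"
  and G_countable: "x \<in> topspace X \<Longrightarrow> countable (\<W> x)"
  and G_network: "x \<in> topspace X \<Longrightarrow> \<W>' \<subseteq> \<W> x \<Longrightarrow> infinite \<W>' \<Longrightarrow> network_at X x \<W>'"
  using G by (auto simp: open_uniform_G_at_nonisolated_def)

section \<open>Chosen neighbourhoods and point-finite refinements\<close>

definition G_nbhd :: "'a \<Rightarrow> 'a set \<Rightarrow> 'a set" where
  "G_nbhd x U = (SOME V. openin X V \<and> x \<in> V \<and> V \<subseteq> U \<and>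
     (\<forall>y \<in> V \<inter> nonisolated_points X. \<exists>W \<in> \<W> y. x \<in> W \<and> W \<subseteq> U))"

lemma G_nbhd:
  assumes U: "openin X U" "x \<in> U"
  shows "openin X (G_nbhd x U)" "x \<in> G_nbhd x U" "G_nbhd x U \<subseteq> U"
    "y \<in> G_nbhd x U \<Longrightarrow> y \<in> nonisolated_points X \<Longrightarrow> \<exists>W\<in>\<W> y. x \<in> W \<and> W \<subseteq> U"
proof -
  have "\<forall>x U. openin X U \<and> x \<in> U \<longrightarrow> (\<exists>V. openin X V \<and> x \<in> V \<and>
      (\<forall>y \<in> V \<inter> nonisolated_points X. \<exists>W \<in> \<W> y. x \<in> W \<and> W \<subseteq> U))"
    using G by (simp add: open_uniform_G_at_nonisolated_def)
  then obtain V where V: "openin X V" "x \<in> V"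
    "\<forall>y \<in> V \<inter> nonisolated_points X. \<exists>W \<in> \<W> y. x \<in> W \<and> W \<subseteq> U"
    using U by meson
  have "openin X (G_nbhd x U) \<and> x \<in> G_nbhd x U \<and> G_nbhd x U \<subseteq> U \<and>
      (\<forall>y \<in> G_nbhd x U \<inter> nonisolated_points X. \<exists>W \<in> \<W> y. x \<in> W \<and> W \<subseteq> U)"
    unfolding G_nbhd_def by (rule someI[of _ "V \<inter> U"]) (use U V in auto)
  then show "openin X (G_nbhd x U)" "x \<in> G_nbhd x U" "G_nbhd x U \<subseteq> U"
    "y \<in> G_nbhd x U \<Longrightarrow> y \<in> nonisolated_points X \<Longrightarrow> \<exists>W\<in>\<W> y. x \<in> W \<and> W \<subseteq> U"
    by auto
qed

text \<open>At a non-isolated \<open>p\<close>, taking \<open>y = p\<close> in \<open>G_nbhd\<close>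
  shows that \<open>\<W> p\<close> is a local base; finite intersections along an enumeration of
  this countable family decrease and eventually enter every neighbourhood.\<close>

lemma G_shrinking_neighbourhoods:
  assumes p: "p \<in> topspace X"
  shows "\<exists>C :: nat \<Rightarrow> 'a set. (\<forall>n. openin X (C n) \<and> p \<in> C n) \<and>
    (\<forall>U. openin X U \<longrightarrow> p \<in> U \<longrightarrow> (\<exists>k. \<forall>n\<ge>k. C n \<subseteq> U))"
proof (cases "p \<in> nonisolated_points X")
  case False
  then show ?thesis
    using p by (intro exI[of _ "\<lambda>n. {p}"]) (auto simp: nonisolated_points_iff)
next
  case True
  have local_base: "\<exists>W\<in>\<W> p. W \<subseteq> U" if "openin X U" "p \<in> U" for U
    using G_nbhd[OF that] True by meson
  then have ne: "\<W> p \<noteq> {}"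
    using p by blast
  define C where "C = (\<lambda>n. \<Inter>i\<le>n. from_nat_into (\<W> p) i)"
  have W: "openin X (from_nat_into (\<W> p) i)" "p \<in> from_nat_into (\<W> p) i" for i
    using G_open[OF p] G_mem[OF p] from_nat_into[OF ne] by auto
  have "\<forall>n. openin X (C n) \<and> p \<in> C n"
    unfolding C_def using W by (auto intro!: openin_INT2)
  moreover have "\<forall>U. openin X U \<longrightarrow> p \<in> U \<longrightarrow> (\<exists>k. \<forall>n\<ge>k. C n \<subseteq> U)"
  proof (intro allI impI)
    fix U assume U: "openin X U" "p \<in> U"
    obtain W where "W \<in> \<W> p" "W \<subseteq> U"
      using local_base U by blast
    then obtain k where "from_nat_into (\<W> p) k \<subseteq> U"
      using from_nat_into_surj[OF G_countable[OF p]] by metis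
    then show "\<exists>k. \<forall>n\<ge>k. C n \<subseteq> U"
      unfolding C_def by (intro exI[of _ k]) auto
  qed
  ultimately show ?thesis
    by blast
qed

lemma G_point_finite_refinement:
  fixes U :: "'i \<Rightarrow> 'a set"
  assumes opn: "\<And>i. openin X (U i)" and cover: "topspace X \<subseteq> (\<Union>i. U i)"
  obtains V :: "'i \<Rightarrow> 'a set" where "\<And>i. openin X (V i)" "\<And>i. V i \<subseteq> U i"
    "topspace X \<subseteq> (\<Union>i. V i)" "\<And>y. y \<in> nonisolated_points X \<Longrightarrow> finite {i. y \<in> V i}"
proof -
  obtain r :: "'i rel" where r: "Well_order r" "Field r = UNIV"
    using well_order_on[of "UNIV :: 'i set"] by (metis well_order_on_Field)
  interpret wo_rel r
    using r(1) by (simp add: wo_rel_def)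
  define a where "a = (\<lambda>x. minim {i. x \<in> U i})"
  have a_in: "x \<in> U (a x)" if "x \<in> topspace X" for x
    using minim_in[of "{i. x \<in> U i}"] cover that r(2) by (auto simp: a_def)
  have a_least: "(a x, i) \<in> r" if "x \<in> U i" for x i
    using minim_least[of "{i. x \<in> U i}" i] that r(2) by (auto simp: a_def)
  have antisym: "i = j" if "(i, j) \<in> r" "(j, i) \<in> r" for i j
    using ANTISYM that by (auto dest: antisymD)
  define V where "V = (\<lambda>i. \<Union>x\<in>{x \<in> topspace X. a x = i}. G_nbhd x (U i))"
  show thesis
  proof (rule that)
    show "openin X (V i)" for i
      unfolding V_def using G_nbhd(1) opn a_in by (intro openin_Union) auto
    show "V i \<subseteq> U i" for i
      unfolding V_def using G_nbhd(3)[OF opn] a_in by blast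
    show "topspace X \<subseteq> (\<Union>i. V i)"
      unfolding V_def using G_nbhd(2)[OF opn] a_in by blast
    fix y assume y: "y \<in> nonisolated_points X"
    then have yX: "y \<in> topspace X"
      by (simp add: nonisolated_points_iff)
    define A where "A = {i. y \<in> V i \<and> i \<noteq> a y}"
    have "\<exists>x W. a x = i \<and> x \<in> W \<and> W \<in> \<W> y \<and> W \<subseteq> U i" if "i \<in> A" for i
      using that G_nbhd(4)[OF opn a_in] y unfolding A_def V_def by blast
    then obtain x W where xW: "\<And>i. i \<in> A \<Longrightarrow> a (x i) = i"
      "\<And>i. i \<in> A \<Longrightarrow> x i \<in> W i" "\<And>i. i \<in> A \<Longrightarrow> W i \<in> \<W> y" "\<And>i. i \<in> A \<Longrightarrow> W i \<subseteq> U i"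
      by metis
    \<comment> \<open>If \<open>W i = W j\<close>, then \<open>x i\<close> lies in
      \<open>U j\<close> and has first index \<open>i\<close>, so \<open>i\<close> precedes
      \<open>j\<close>; by symmetry the indices agree.\<close>
    have "inj_on W A"
    proof
      fix i j assume ij: "i \<in> A" "j \<in> A" "W i = W j"
      then have "x i \<in> U j" "x j \<in> U i"
        using xW by blast+
      then show "i = j"
        using a_least antisym xW(1) ij(1,2) by metis
    qed
    have "finite A"
    proof (rule ccontr)
      assume "infinite A"
      then have "infinite (W ` A)"
        using \<open>inj_on W A\<close> finite_imageD by blast
      then have "network_at X y (W ` A)"
        using G_network[OF yX] xW(3) by blast
      \<comment> \<open>Now \<open>x i \<in> U (a y)\<close> puts \<open>i\<close> before
        \<open>a y\<close>, while \<open>y \<in> W i \<subseteq> U i\<close> puts \<open>a y\<close>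
        before \<open>i\<close>; but \<open>A\<close> omits \<open>a y\<close>.\<close>
      then obtain i where i: "i \<in> A" "W i \<subseteq> U (a y)"
        using opn a_in[OF yX] unfolding network_at_def by blast
      then have "(i, a y) \<in> r"
        using a_least xW(1,2) by (metis subsetD)
      moreover have "(a y, i) \<in> r"
        using a_least G_mem[OF yX] xW(3,4) i(1) by blast
      ultimately show False
        using antisym i(1) by (auto simp: A_def)
    qed
    moreover have "{i. y \<in> V i} \<subseteq> insert (a y) A"
      by (auto simp: A_def)
    ultimately show "finite {i. y \<in> V i}"
      by (meson finite_insert finite_subset)
  qed
qed

lemma G_finite_containing:
  assumes "t1_space X" "x \<in> topspace X" "p \<noteq> x"
  shows "finite {W \<in> \<W> x. p \<in> W}"
proof (rule ccontr)
  assume "infinite {W \<in> \<W> x. p \<in> W}"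
  then have "network_at X x {W \<in> \<W> x. p \<in> W}"
    by (intro G_network assms) auto
  moreover have "openin X (topspace X - {p})" "x \<in> topspace X - {p}"
    using openin_delete[OF assms(1) openin_topspace] assms by auto
  ultimately show False
    unfolding network_at_def by blast
qed

section \<open>A refining sequence of point-finite covers\<close>

text \<open>A centre \<open>p\<close> may lie outside its own set \<open>V p\<close>. The clause on
  isolated centres ensures that a set containing a non-isolated point has a non-isolated
  centre.\<close>

definition admissible :: "('a \<Rightarrow> 'a set) \<Rightarrow> bool" where
  "admissible V \<longleftrightarrow> (\<forall>p. openin X (V p)) \<and> (\<forall>p. p \<notin> topspace X \<longrightarrow> V p = {}) \<and>
     (\<forall>p. p \<notin> nonisolated_points X \<longrightarrow> V p \<subseteq> {p}) \<and>
     (\<forall>y\<in>nonisolated_points X. finite {p. y \<in> V p})"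

text \<open>\<open>H p\<close> collects the centres of all earlier sets that contain \<open>p\<close>.\<close>

definition refines_to :: "'a set \<Rightarrow> ('a \<Rightarrow> 'a set) \<Rightarrow> ('a \<Rightarrow> 'a set) \<Rightarrow> 'a \<Rightarrow> 'a set \<Rightarrow> 'a set \<Rightarrow> bool" where
  "refines_to C V H p B V' \<longleftrightarrow> V' \<subseteq> B \<and> B \<subseteq> C \<and> (\<forall>x. p \<in> V x \<longrightarrow> B \<subseteq> V x) \<and>
     (\<forall>x\<in>H p - {p}. x \<notin> B \<and> (\<forall>W\<in>\<W> x. p \<in> W \<longrightarrow> B \<subseteq> W)) \<and>
     (\<forall>y\<in>V' \<inter> nonisolated_points X. \<exists>W\<in>\<W> y. p \<in> W \<and> W \<subseteq> B)"

text \<open>Lets the recursion carry an upper bound \<open>H\<close> for the history in place of the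
  exact set of earlier centres.\<close>

lemma refines_to_history_mono:
  assumes "refines_to C V H p B V'" and sub: "H' p \<subseteq> H p"
  shows "refines_to C V H' p B V'"
proof -
  have "\<forall>x\<in>H p - {p}. x \<notin> B \<and> (\<forall>W\<in>\<W> x. p \<in> W \<longrightarrow> B \<subseteq> W)"
    using assms(1) by (simp add: refines_to_def)
  then have "\<forall>x\<in>H' p - {p}. x \<notin> B \<and> (\<forall>W\<in>\<W> x. p \<in> W \<longrightarrow> B \<subseteq> W)"
    using sub by (meson Diff_mono order_refl subsetD)
  then show ?thesis
    using assms(1) by (simp add: refines_to_def)
qed

text \<open>At a non-isolated \<open>p\<close> the requirements on \<open>B p\<close> amount to
  finitely many open neighbourhoods of \<open>p\<close>, so their intersection is open. Shrinking
  \<open>B p\<close> by \<open>G_nbhd\<close> and then refining point-finitely gives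
  \<open>V'\<close>.\<close>

lemma refinement_step:
  assumes t1: "t1_space X" and V: "admissible V"
    and H: "\<And>p. H p \<subseteq> topspace X" "\<And>p. p \<in> nonisolated_points X \<Longrightarrow> finite (H p)"
    and C: "\<And>p. p \<in> topspace X \<Longrightarrow> openin X (C p) \<and> p \<in> C p"
  obtains B V' where "admissible V'" "topspace X \<subseteq> (\<Union>p. V' p)"
    "\<And>p. p \<in> topspace X \<Longrightarrow> refines_to (C p) V H p (B p) (V' p)"
proof -
  define F where "F = (\<lambda>p. V ` {x. p \<in> V x} \<union> (\<lambda>x. topspace X - {x}) ` (H p - {p})
    \<union> (\<Union>x\<in>H p - {p}. {W \<in> \<W> x. p \<in> W}))"
  \<comment> \<open>At an isolated \<open>p\<close> the family \<open>F p\<close> may be infinite;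
    \<open>{p}\<close> is open and lies in every neighbourhood of \<open>p\<close> anyway.\<close>
  define B where "B = (\<lambda>p. if p \<in> nonisolated_points X then C p \<inter> \<Inter>(F p) else {p})"
  have F: "openin X T \<and> p \<in> T" if "p \<in> topspace X" "T \<in> F p" for p T
  proof -
    consider x where "T = V x" "p \<in> V x" | x where "T = topspace X - {x}" "x \<noteq> p"
      | x where "x \<in> H p" "T \<in> \<W> x" "p \<in> T"
      using \<open>T \<in> F p\<close> unfolding F_def by blast
    then show ?thesis
    proof cases
      case 1
      then show ?thesis
        using V by (simp add: admissible_def)
    next
      case 2
      then show ?thesis
        using that openin_delete[OF t1 openin_topspace] by simp
    next
      case 3
      then show ?thesis
        using H(1)[of p] G_open by blast
    qed
  qed
  have finite_F: "finite (F p)" if "p \<in> nonisolated_points X" for p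
  proof -
    have "finite {W \<in> \<W> x. p \<in> W}" if "x \<in> H p - {p}" for x
      using that H(1)[of p] by (intro G_finite_containing[OF t1]) auto
    moreover have "finite {x. p \<in> V x}"
      using V that by (simp add: admissible_def)
    ultimately show ?thesis
      unfolding F_def using H(2)[OF that] by simp
  qed
  have "openin X (B p) \<and> p \<in> B p" if p: "p \<in> topspace X" for p
  proof (cases "p \<in> nonisolated_points X")
    case False
    then show ?thesis
      using p by (simp add: B_def nonisolated_points_iff)
  next
    case True
    have "openin X (C p \<inter> \<Inter>(F p))"
      using C[OF p] F[OF p] finite_F[OF True]
      by (cases "F p = {}") (auto intro!: openin_Int openin_Inter)
    then show ?thesis
      using True C[OF p] F[OF p] by (simp add: B_def)
  qed
  then have B: "openin X (B p)" "p \<in> B p" if "p \<in> topspace X" for p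
    using that by auto
  define U where "U = (\<lambda>p. if p \<in> topspace X then G_nbhd p (B p) else {})"
  have "openin X (U p)" for p
    using G_nbhd(1) B by (auto simp: U_def)
  moreover have "topspace X \<subseteq> (\<Union>p. U p)"
    using G_nbhd(2) B by (auto simp: U_def)
  ultimately obtain V' where V': "\<And>p. openin X (V' p)" "\<And>p. V' p \<subseteq> U p"
    "topspace X \<subseteq> (\<Union>p. V' p)" "\<And>y. y \<in> nonisolated_points X \<Longrightarrow> finite {p. y \<in> V' p}"
    using G_point_finite_refinement[of U] by blast
  have sub: "V' p \<subseteq> B p" if "p \<in> topspace X" for p
    using V'(2)[of p] G_nbhd(3)[OF B] that by (auto simp: U_def)
  show thesis
  proof (rule that)
    have "V' p = {}" if "p \<notin> topspace X" for p
      using V'(2)[of p] that by (auto simp: U_def)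
    moreover have "V' p \<subseteq> {p}" if "p \<notin> nonisolated_points X" for p
      using calculation[of p] sub[of p] that by (cases "p \<in> topspace X") (auto simp: B_def)
    ultimately show "admissible V'"
      using V' unfolding admissible_def by blast
    show "topspace X \<subseteq> (\<Union>p. V' p)"
      by (rule V')
    fix p assume p: "p \<in> topspace X"
    have 1: "B p \<subseteq> C p \<and> (\<forall>x. p \<in> V x \<longrightarrow> B p \<subseteq> V x) \<and>
        (\<forall>x\<in>H p - {p}. x \<notin> B p \<and> (\<forall>W\<in>\<W> x. p \<in> W \<longrightarrow> B p \<subseteq> W))"
      using C[OF p] by (auto simp: B_def F_def)
    have 2: "\<exists>W\<in>\<W> y. p \<in> W \<and> W \<subseteq> B p" if "y \<in> V' p \<inter> nonisolated_points X" for y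
    proof (rule G_nbhd(4)[OF B[OF p]])
      show "y \<in> G_nbhd p (B p)"
        using V'(2)[of p] that p by (auto simp: U_def)
    qed (use that in simp)
    show "refines_to (C p) V H p (B p) (V' p)"
      unfolding refines_to_def using sub[OF p] 1 2 by simp
  qed
qed

text \<open>Each step depends on all earlier covers, so dependent choice runs over pairs of a cover
  \<open>V\<close> and an accumulated history \<open>H\<close>, finite at non-isolated
  points.\<close>

lemma refinement_sequence:
  assumes t1: "t1_space X" and C: "\<And>p n. p \<in> topspace X \<Longrightarrow> openin X (C p n) \<and> p \<in> C p n"
  shows "\<exists>V B. (\<forall>n. admissible (V n) \<and> topspace X \<subseteq> (\<Union>p. V n p)) \<and> (\<forall>n. \<forall>p\<in>topspace X.
      refines_to (C p n) (V n) (\<lambda>p. {x. \<exists>m\<le>n. p \<in> V m x}) p (B n p) (V (Suc n) p))"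
proof -
  define P where "P = (\<lambda>(V, H). admissible V \<and> topspace X \<subseteq> (\<Union>p. V p) \<and>
    (\<forall>p. {x. p \<in> V x} \<subseteq> H p \<and> H p \<subseteq> topspace X) \<and> (\<forall>p\<in>nonisolated_points X. finite (H p)))"
  define Q where "Q = (\<lambda>n (V, H) (V', H').
    (\<exists>B. \<forall>p\<in>topspace X. refines_to (C p n) V H p (B p) (V' p)) \<and>
    (\<forall>p. H p \<subseteq> H' p))"
  have centres: "{x. p \<in> V x} \<subseteq> topspace X" if "admissible V" for V p
    using that unfolding admissible_def by blast
  have "\<exists>f. \<forall>n. P (f n) \<and> Q n (f n) (f (Suc n))"
  proof (rule dependent_nat_choice)
    \<comment> \<open>The initial cover arises by refining the empty family with empty
      history.\<close>
    have triv: "admissible (\<lambda>p. {})"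
      by (simp add: admissible_def)
    obtain V where V: "admissible V" "topspace X \<subseteq> (\<Union>p. V p)"
      by (rule refinement_step[OF t1 triv, of "\<lambda>p. {}" "\<lambda>p. C p 0"]) (use C in auto)
    have "P (V, \<lambda>p. {x. p \<in> V x})"
      using V centres[OF V(1)] by (auto simp: P_def admissible_def)
    then show "\<exists>s. P s" ..
  next
    fix s :: "('a \<Rightarrow> 'a set) \<times> ('a \<Rightarrow> 'a set)" and n assume s: "P s"
    obtain V H where sVH: "s = (V, H)" by fastforce
    have VH: "admissible V" "\<And>p. H p \<subseteq> topspace X"
      "\<And>p. p \<in> nonisolated_points X \<Longrightarrow> finite (H p)"
      using s by (auto simp: sVH P_def)
    obtain B V' where V': "admissible V'" "topspace X \<subseteq> (\<Union>p. V' p)"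
      "\<And>p. p \<in> topspace X \<Longrightarrow> refines_to (C p n) V H p (B p) (V' p)"
      by (rule refinement_step[OF t1 VH, where C = "\<lambda>p. C p n"]) (use C in auto)
    have "P (V', \<lambda>p. H p \<union> {x. p \<in> V' x})"
      using V' VH centres[OF V'(1)] by (auto simp: P_def admissible_def)
    moreover have "Q n s (V', \<lambda>p. H p \<union> {x. p \<in> V' x})"
      using V'(3) by (auto simp: Q_def sVH)
    ultimately show "\<exists>s'. P s' \<and> Q n s s'" by blast
  qed
  then obtain f where f: "\<And>n. P (f n)" "\<And>n. Q n (f n) (f (Suc n))"
    by blast
  define V where "V = (\<lambda>n. fst (f n))"
  define H where "H = (\<lambda>n. snd (f n))"
  have VP: "admissible (V n)" "topspace X \<subseteq> (\<Union>p. V n p)" "{x. p \<in> V n x} \<subseteq> H n p" for n p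
    using f(1)[of n] by (auto simp: P_def V_def H_def split: prod.splits)
  have VQ: "\<exists>B. \<forall>p\<in>topspace X. refines_to (C p n) (V n) (H n) p (B p) (V (Suc n) p)"
    "H n p \<subseteq> H (Suc n) p" for n p
    using f(2)[of n] by (auto simp: Q_def V_def H_def split: prod.splits)
  have "H m p \<subseteq> H n p" if "m \<le> n" for m n p
    using that VQ(2) by (rule lift_Suc_mono_le[rotated])
  then have hist: "{x. \<exists>m\<le>n. p \<in> V m x} \<subseteq> H n p" for n p
    using VP(3) by blast
  obtain B where B: "\<And>n p. p \<in> topspace X \<Longrightarrow>
      refines_to (C p n) (V n) (H n) p (B n p) (V (Suc n) p)"
    using VQ(1) by metis
  show ?thesis
  proof (rule exI[of _ V], rule exI[of _ B], intro conjI allI ballI VP(1,2))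
    show "refines_to (C p n) (V n) (\<lambda>p. {x. \<exists>m\<le>n. p \<in> V m x}) p (B n p) (V (Suc n) p)"
      if "p \<in> topspace X" for n p
      by (rule refines_to_history_mono[where H = "H n"]) (rule B[OF that], rule hist)
  qed
qed

section \<open>Decreasing chains of sets around a non-isolated point\<close>

text \<open>Excludes the infinite branch that Koenig's lemma would produce. The sets decrease
  because \<open>B n (x (Suc n))\<close> lies in every level-\<open>n\<close> set containing
  \<open>x (Suc n)\<close>.\<close>

lemma no_bad_chain:
  assumes t1: "t1_space X"
    and C: "\<And>p U. openin X U \<Longrightarrow> p \<in> U \<Longrightarrow> \<exists>k. \<forall>n\<ge>k. C p n \<subseteq> U"
    and V: "\<And>n. admissible (V n)"
    and R: "\<And>n p. p \<in> topspace X \<Longrightarrow>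
      refines_to (C p n) (V n) (\<lambda>p. {x. \<exists>m\<le>n. p \<in> V m x}) p (B n p) (V (Suc n) p)"
    and y: "y \<in> nonisolated_points X" and U: "openin X U" "y \<in> U"
    and chain: "\<And>n. x (Suc n) \<in> V n (x n)" and mem: "\<And>n. y \<in> V n (x n)"
  shows "\<exists>n. V n (x n) \<subseteq> U"
proof (rule ccontr)
  assume "\<not> ?thesis"
  then have bad: "\<not> V n (x n) \<subseteq> U" for n
    by blast
  have yX: "y \<in> topspace X"
    using y by (simp add: nonisolated_points_iff)
  have x_noniso: "x n \<in> nonisolated_points X" for n
    using V[of n] mem[of n] y unfolding admissible_def by blast
  then have xX: "x n \<in> topspace X" for n
    by (simp add: nonisolated_points_iff)
  have R': "refines_to (C (x (Suc n)) n) (V n) (\<lambda>p. {z. \<exists>m\<le>n. p \<in> V m z})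
      (x (Suc n)) (B n (x (Suc n))) (V (Suc n) (x (Suc n)))" for n
    by (rule R[OF xX])
  have VB: "V (Suc n) (x (Suc n)) \<subseteq> B n (x (Suc n))"
    and BC: "B n (x (Suc n)) \<subseteq> C (x (Suc n)) n"
    and BV: "B n (x (Suc n)) \<subseteq> V n (x n)"
    and avoid: "m \<le> n \<Longrightarrow> x (Suc n) \<in> V m z \<Longrightarrow> z \<noteq> x (Suc n) \<Longrightarrow> z \<notin> B n (x (Suc n))"
    and inside: "m \<le> n \<Longrightarrow> x (Suc n) \<in> V m z \<Longrightarrow> z \<noteq> x (Suc n) \<Longrightarrow> W \<in> \<W> z \<Longrightarrow>
      x (Suc n) \<in> W \<Longrightarrow> B n (x (Suc n)) \<subseteq> W"
    and trace: "\<exists>W\<in>\<W> y. x (Suc n) \<in> W \<and> W \<subseteq> B n (x (Suc n))" for m n z W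
    using R'[of n, unfolded refines_to_def] chain[of n] mem[of "Suc n"] y
    by simp_all blast+
  have "V (Suc n) (x (Suc n)) \<subseteq> V n (x n)" for n
    using VB BV by blast
  then have V_mono: "V n (x n) \<subseteq> V m (x m)" if "m \<le> n" for m n
    using that by (rule lift_Suc_antimono_le[of "\<lambda>n. V n (x n)"])
  have later: "x (Suc n) \<in> V m (x m)" if "m \<le> n" for m n
    using V_mono[OF that] chain by blast
  \<comment> \<open>With a constant tail of centres the sets lie in \<open>C (x N) n\<close>, which
    eventually misses \<open>y\<close> if \<open>x N \<noteq> y\<close> and eventually enters
    \<open>U\<close> if \<open>x N = y\<close>.\<close>
  have const: "\<exists>n\<ge>N. x (Suc n) \<noteq> x N" for N
  proof (rule ccontr)
    assume "\<not> ?thesis"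
    then have eq: "x (Suc n) = x N" if "n \<ge> N" for n
      using that by blast
    have sub: "V (Suc n) (x (Suc n)) \<subseteq> C (x N) n" if "n \<ge> N" for n
      using order_trans[OF VB[of n] BC[of n]] eq[OF that] by simp
    have "x N = y"
    proof (rule ccontr)
      assume "x N \<noteq> y"
      then obtain k where "\<forall>n\<ge>k. C (x N) n \<subseteq> topspace X - {y}"
        using C[OF openin_delete[OF t1 openin_topspace], of "x N" y] xX by blast
      then have "C (x N) (max k N) \<subseteq> topspace X - {y}"
        by simp
      then show False
        using sub[of "max k N"] mem[of "Suc (max k N)"] by auto
    qed
    then obtain k where "\<forall>n\<ge>k. C (x N) n \<subseteq> U"
      using C[OF U(1), of "x N"] U(2) by blast
    then have "C (x N) (max k N) \<subseteq> U"
      by simp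
    then show False
      using sub[of "max k N"] bad[of "Suc (max k N)"] by auto
  qed
  \<comment> \<open>A later centre different from \<open>x N\<close> lies in
    \<open>V N (x N)\<close>, so \<open>x N\<close> belongs to its history and is omitted from its
    \<open>B\<close>.\<close>
  have dropped: "\<exists>n\<ge>N. x N \<notin> B n (x (Suc n))" for N
  proof -
    obtain n where n: "n \<ge> N" "x N \<noteq> x (Suc n)"
      using const[of N] by auto
    then show ?thesis
      using avoid[OF n(1) later[OF n(1)] n(2)] by blast
  qed
  have "\<forall>n. \<exists>W. W \<in> \<W> y \<and> x (Suc n) \<in> W \<and> W \<subseteq> B n (x (Suc n))"
    using trace by blast
  then have "\<exists>W. \<forall>n. W n \<in> \<W> y \<and> x (Suc n) \<in> W n \<and> W n \<subseteq> B n (x (Suc n))"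
    by (rule choice)
  then obtain W where W: "\<And>n. W n \<in> \<W> y" "\<And>n. x (Suc n) \<in> W n"
    "\<And>n. W n \<subseteq> B n (x (Suc n))"
    by blast
  \<comment> \<open>Otherwise some \<open>W n0\<close> recurs arbitrarily late and keeps
    \<open>x (Suc n0)\<close> inside late sets of the chain, although that centre is omitted from
    some \<open>B m\<close> containing them.\<close>
  have inf: "infinite (W ` {N..})" for N
  proof
    assume "finite (W ` {N..})"
    then obtain n0 where n0: "infinite {n \<in> {N..}. W n = W n0}"
      using pigeonhole_infinite[of "{N..}" W] infinite_Ici by blast
    obtain m where m: "m \<ge> Suc n0" "x (Suc n0) \<notin> B m (x (Suc m))"
      using dropped by blast
    obtain n where n: "n > m" "W n = W n0"
      using n0 unfolding infinite_nat_iff_unbounded by blast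
    have "x (Suc n0) \<in> B n (x (Suc n))"
      using W(2,3) n(2) by (metis subsetD)
    also have "\<dots> \<subseteq> V n (x n)"
      by (rule BV)
    also have "\<dots> \<subseteq> V (Suc m) (x (Suc m))"
      using n(1) by (intro V_mono) simp
    also have "\<dots> \<subseteq> B m (x (Suc m))"
      by (rule VB)
    finally show False
      using m(2) by contradiction
  qed
  have accum: "\<exists>n\<ge>N. x (Suc n) \<in> O'" if "openin X O'" "y \<in> O'" for N O'
  proof -
    have "network_at X y (W ` {N..})"
      using W(1) inf by (intro G_network[OF yX]) auto
    from this[unfolded network_at_def, rule_format, OF conjI[OF that]]
    obtain n where "n \<ge> N" "W n \<subseteq> O'"
      by auto
    then show ?thesis
      using W(2) by blast
  qed
  obtain n where n: "x (Suc n) \<in> G_nbhd y U"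
    using accum[OF G_nbhd(1,2)[OF U]] by blast
  obtain S where S: "S \<in> \<W> (x (Suc n))" "y \<in> S" "S \<subseteq> U"
    using G_nbhd(4)[OF U n x_noniso] by blast
  \<comment> \<open>Every centre is omitted from some later \<open>B\<close>, whereas
    \<open>y\<close> stays in all of them.\<close>
  have "y \<noteq> x (Suc n)"
    using dropped[of "Suc n"] VB mem by blast
  \<comment> \<open>Deleting \<open>x (Suc n)\<close> from \<open>S\<close> makes the later centre a
    different one, as \<open>inside\<close> requires; its set is then trapped in
    \<open>S \<subseteq> U\<close>.\<close>
  then obtain m where m: "m \<ge> Suc n" "x (Suc m) \<in> S - {x (Suc n)}"
    using accum[OF openin_delete[OF t1 G_open[OF xX S(1)]], of "x (Suc n)" "Suc n"] S(2) by blast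
  have "B m (x (Suc m)) \<subseteq> S"
    using inside[OF m(1) later[OF m(1)] _ S(1)] m(2) by auto
  then show False
    using VB[of m] S(3) bad[of "Suc m"] by blast
qed

section \<open>Assembling the uniform base\<close>

lemma open_uniform_G_imp_uniform_base:
  assumes t1: "t1_space X"
  shows "has_uniform_base_at_nonisolated X"
proof -
  have "\<forall>p\<in>topspace X. \<exists>C :: nat \<Rightarrow> 'a set. (\<forall>n. openin X (C n) \<and> p \<in> C n) \<and>
      (\<forall>U. openin X U \<longrightarrow> p \<in> U \<longrightarrow> (\<exists>k. \<forall>n\<ge>k. C n \<subseteq> U))"
    using G_shrinking_neighbourhoods by simp
  from bchoice[OF this] obtain C :: "'a \<Rightarrow> nat \<Rightarrow> 'a set" where
    C: "\<forall>p\<in>topspace X. (\<forall>n. openin X (C p n) \<and> p \<in> C p n) \<and>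
      (\<forall>U. openin X U \<longrightarrow> p \<in> U \<longrightarrow> (\<exists>k. \<forall>n\<ge>k. C p n \<subseteq> U))"
    by blast
  then have C1: "openin X (C p n) \<and> p \<in> C p n" if "p \<in> topspace X" for p n
    using that by blast
  have C2: "\<exists>k. \<forall>n\<ge>k. C p n \<subseteq> U" if "openin X U" "p \<in> U" for p U
    using C that openin_subset[OF that(1)] by blast
  obtain V B where V: "\<And>n. admissible (V n)" "\<And>n. topspace X \<subseteq> (\<Union>p. V n p)"
    and R: "\<And>n p. p \<in> topspace X \<Longrightarrow>
      refines_to (C p n) (V n) (\<lambda>p. {x. \<exists>m\<le>n. p \<in> V m x}) p (B n p) (V (Suc n) p)"
    using refinement_sequence[OF t1, of C, OF C1] by blast
  have opn: "openin X (V n p)" for n p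
    using V(1)[of n] unfolding admissible_def by blast
  have finite_bad: "finite {(n, p). y \<in> V n p \<and> \<not> V n p \<subseteq> U}" (is "finite ?bad")
    if y: "y \<in> nonisolated_points X" and U: "openin X U" "y \<in> U" for y U
  proof (rule ccontr)
    assume inf: "infinite ?bad"
    \<comment> \<open>Edges join bad pairs of consecutive levels; branching is finite because
      \<open>y\<close> lies in finitely many sets of each level.\<close>
    define E where "E = (\<lambda>(n, p) (m, q). m = Suc n \<and> q \<in> V n p \<and>
      (n, p) \<in> ?bad \<and> (m, q) \<in> ?bad)"
    have level: "finite {p. y \<in> V n p}" for n
      using V(1)[of n] y unfolding admissible_def by blast
    have fin: "finite {w. E v w}" for v
    proof (rule finite_subset)
      show "{w. E v w} \<subseteq> {Suc (fst v)} \<times> {p. y \<in> V (Suc (fst v)) p}"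
        by (auto simp: E_def)
    qed (use level in auto)
    \<comment> \<open>The cover at level \<open>n\<close> has a set \<open>V n q\<close> containing
      the centre \<open>p\<close>; it includes \<open>V (Suc n) p\<close>, so it contains
      \<open>y\<close> and also fails to lie in \<open>U\<close>.\<close>
    have from_root: "\<exists>r. (0, r) \<in> ?bad \<and> E\<^sup>*\<^sup>* (0, r) (n, p)" if "(n, p) \<in> ?bad" for n p
      using that
    proof (induction n arbitrary: p)
      case 0
      then show ?case by blast
    next
      case (Suc n)
      have p: "p \<in> topspace X"
        using V(1)[of "Suc n"] Suc.prems unfolding admissible_def by blast
      obtain q where q: "p \<in> V n q"
        using V(2)[of n] p by blast
      then have "V (Suc n) p \<subseteq> V n q"
        using R[OF p, of n] unfolding refines_to_def by blast
      then have "(n, q) \<in> ?bad"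
        using Suc.prems by auto
      moreover from this have "E (n, q) (Suc n, p)"
        using Suc.prems q by (simp add: E_def)
      ultimately show ?case
        using Suc.IH by (meson rtranclp.rtrancl_into_rtrancl)
    qed
    have "?bad \<subseteq> (\<Union>r\<in>{p. y \<in> V 0 p}. {w. E\<^sup>*\<^sup>* (0, r) w})"
      using from_root by fastforce
    then obtain r where r: "infinite {w. E\<^sup>*\<^sup>* (0, r) w}"
      using inf level[of 0] by (meson finite_UN_I finite_subset)
    obtain f where f: "f 0 = (0, r)" "\<And>n. E (f n) (f (Suc n))"
      using koenig[OF fin r] by blast
    have fst: "fst (f n) = n" for n
    proof (induction n)
      case (Suc n)
      then show ?case
        using f(2)[of n] by (auto simp: E_def split: prod.splits)
    qed (simp add: f(1))
    define x where "x = (\<lambda>n. snd (f n))"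
    have "f n = (n, x n)" for n
      using fst[of n] by (simp add: x_def prod_eq_iff)
    then have step: "E (n, x n) (Suc n, x (Suc n))" for n
      using f(2)[of n] by simp
    then have x: "x (Suc n) \<in> V n (x n)" "y \<in> V n (x n)" "\<not> V n (x n) \<subseteq> U" for n
      by (auto simp: E_def)
    show False
      using no_bad_chain[OF t1 C2 V(1) R y U x(1,2)] x(3) by blast
  qed
  \<comment> \<open>The added singletons serve as base sets at isolated points and contain no
    non-isolated point, so they leave uniformity unaffected.\<close>
  define \<P> where "\<P> = range (\<lambda>(n, p). V n p) \<union> {{p} |p. openin X {p}}"
  have "is_base_of \<P> X"
    unfolding is_base_of_def
  proof (intro conjI ballI allI impI)
    show "openin X P" if "P \<in> \<P>" for P
      using that opn by (auto simp: \<P>_def)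
    fix U x assume Ux: "openin X U \<and> x \<in> U"
    then have xX: "x \<in> topspace X"
      using openin_subset by blast
    show "\<exists>P\<in>\<P>. x \<in> P \<and> P \<subseteq> U"
    proof (cases "x \<in> nonisolated_points X")
      case False
      then show ?thesis
        using xX Ux by (intro bexI[of _ "{x}"]) (auto simp: \<P>_def nonisolated_points_iff)
    next
      case True
      have "\<exists>n p. x \<in> V n p \<and> V n p \<subseteq> U"
      proof (rule ccontr)
        assume contra: "\<not> ?thesis"
        have "\<forall>n. \<exists>p. x \<in> V n p"
          using V(2) xX by blast
        \<comment> \<open>Every level covers \<open>x\<close>, so if no set around \<open>x\<close>
          fitted into \<open>U\<close> there would be a bad pair at each of infinitely many
          levels.\<close>
        then have "UNIV \<subseteq> fst ` {(n, p). x \<in> V n p \<and> \<not> V n p \<subseteq> U}"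
          using contra by force
        then show False
          using finite_bad[OF True, of U] Ux infinite_UNIV_nat by (meson finite_imageI finite_subset)
      qed
      then show ?thesis
        by (auto simp: \<P>_def)
    qed
  qed
  moreover have "neighbourhood_base_at x (\<lambda>P. P \<in> \<Q>) X"
    if x: "x \<in> nonisolated_points X" and \<Q>: "\<Q> \<subseteq> {P \<in> \<P>. x \<in> P}" "infinite \<Q>" for x \<Q>
    unfolding neighbourhood_base_at_def
  proof (intro allI impI)
    fix U assume U: "openin X U \<and> x \<in> U"
    have Q_V: "\<exists>n p. Q = V n p" if "Q \<in> \<Q>" for Q
    proof -
      have "x \<in> Q" "\<not> openin X {x}"
        using that \<Q>(1) x by (auto simp: nonisolated_points_iff)
      moreover have "Q \<in> range (\<lambda>(n, p). V n p) \<or> (\<exists>p. Q = {p} \<and> openin X {p})"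
        using that \<Q>(1) by (auto simp: \<P>_def)
      ultimately show ?thesis
        by (elim disjE) auto
    qed
    have "\<exists>Q\<in>\<Q>. Q \<subseteq> U"
    proof (rule ccontr)
      assume contra: "\<not> ?thesis"
      \<comment> \<open>If no member of \<open>\<Q>\<close> lay in \<open>U\<close>, all would come
        from the finitely many bad pairs, although \<open>\<Q>\<close> is infinite.\<close>
      have "\<Q> \<subseteq> (\<lambda>(n, p). V n p) ` {(n, p). x \<in> V n p \<and> \<not> V n p \<subseteq> U}"
      proof
        fix Q assume Q: "Q \<in> \<Q>"
        then obtain n p where "Q = V n p"
          using Q_V by blast
        then show "Q \<in> (\<lambda>(n, p). V n p) ` {(n, p). x \<in> V n p \<and> \<not> V n p \<subseteq> U}"
          using Q contra \<Q>(1) by (intro image_eqI[of _ _ "(n, p)"]) auto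
      qed
      then show False
        using finite_bad[OF x, of U] U \<Q>(2) by (meson finite_imageI finite_subset)
    qed
    then obtain Q where Q: "Q \<in> \<Q>" "Q \<subseteq> U"
      by blast
    then have "openin X Q" "x \<in> Q"
      using Q_V opn \<Q>(1) by blast+
    then show "\<exists>T Q. openin X T \<and> Q \<in> \<Q> \<and> x \<in> T \<and> T \<subseteq> Q \<and> Q \<subseteq> U"
      using Q by blast
  qed
  ultimately show ?thesis
    unfolding has_uniform_base_at_nonisolated_def uniform_base_at_nonisolated_def by blast
qed

end

theorem theorem2p6:
  fixes X :: "'a topology"
  assumes "Hausdorff_space X"
  shows "has_open_uniform_G_at_nonisolated X \<longleftrightarrow> has_uniform_base_at_nonisolated X"
proof -
  have "t1_space X"
    using assms by (rule Hausdorff_imp_t1_space)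
  then show ?thesis
    using uniform_base_imp_open_uniform_G open_uniform_G_imp_uniform_base
    unfolding has_open_uniform_G_at_nonisolated_def has_uniform_base_at_nonisolated_def
    by blast
qed

end
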